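(* Let $n\ge 1$ and let $X_1,\dots,X_n$ be exchangeable real random variables with finite expected value. Then the optimal threshold index $c_*(n)$ satisfies $$\sum_{k=c_*(n)-1}^{n-1}\frac{1}{k} > 1,$$ where, if $c_*(n)=1$, the term $1/0$ is read as $+\infty$ (so that the inequality is then vacuously true). In particular, $c_*(n)\lesssim n/e$; that is, if for each $n$ an exchangeable family $(X^{(n)}_k)_{k=1,\dots,n}$ of real random variables with finite expected value is given and $c_*(n)$ denotes its optimal threshold index, then $\limsup_{n\to\infty} c_*(n)/n\le 1/e$.
   Context: A recruiter interviews $n$ candidates one by one; candidate $k$ has quality $X_k$, where $X_1,\dots,X_n$ are exchangeable with finite expected value. Put $\mu=\mathbb{E}[X_1]$ and, for $1\le k\le n$, $\mu_k=\mathbb{E}[\max\{X_1,\dots,X_k\}]$ (this equals the conditional expectation of $X_k$ given that candidate $k$ is the best among the first $k$, ties being broken at random). For $c\in\{1,\dots,n\}$, let $V_n(c)$ be the expected quality of the hired candidate under the strategy which rejects the first $c-1$ candidates and from then on hires the first candidate who is the best so far (ties broken at random), the last candidate being hired if no other has been. Explicitly, $V_n(1)=\mathbb{E}[X_1]$ and, for $2\le c\le n$, $$V_n(c)=\sum_{k=c}^{n-1}\mu_k\,\frac{c-1}{k-1}\,\frac1k+\frac{c-1}{n-1}\,\mu .$$ The optimal threshold index $c_*(n)$ is the smallest $c\in\{1,\dots,n\}$ maximizing $V_n(c)$. *)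

theory Defs
  imports "HOL-Probability.Probability"
begin

definition exchangeable :: "'a measure \<Rightarrow> nat \<Rightarrow> (nat \<Rightarrow> 'a \<Rightarrow> real) \<Rightarrow> bool" where
  "exchangeable M n X \<longleftrightarrow>
     (\<forall>k\<in>{1..n}. X k \<in> borel_measurable M) \<and>
     (\<forall>\<pi>. \<pi> permutes {1..n} \<longrightarrow>
        distr M (PiM {1..n} (\<lambda>_. borel)) (\<lambda>\<omega>. \<lambda>k\<in>{1..n}. X (\<pi> k) \<omega>) =
        distr M (PiM {1..n} (\<lambda>_. borel)) (\<lambda>\<omega>. \<lambda>k\<in>{1..n}. X k \<omega>))"

definition expected_max :: "'a measure \<Rightarrow> (nat \<Rightarrow> 'a \<Rightarrow> real) \<Rightarrow> nat \<Rightarrow> real" where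
  "expected_max M X k = (\<integral>\<omega>. Max ((\<lambda>j. X j \<omega>) ` {1..k}) \<partial>M)"

(* Random tie breaking: s is a permutation of the candidates, drawn uniformly and independently
   of the qualities; among candidates of equal quality the one with the larger s-value is preferred. *)

definition worse :: "(nat \<Rightarrow> nat) \<Rightarrow> (nat \<Rightarrow> real) \<Rightarrow> nat \<Rightarrow> nat \<Rightarrow> bool" where
  "worse s x j k \<longleftrightarrow> x j < x k \<or> (x j = x k \<and> s j < s k)"

definition best_in :: "(nat \<Rightarrow> nat) \<Rightarrow> (nat \<Rightarrow> real) \<Rightarrow> nat set \<Rightarrow> nat \<Rightarrow> bool" where
  "best_in s x S k \<longleftrightarrow> k \<in> S \<and> (\<forall>j\<in>S - {k}. worse s x j k)"

definition hired :: "(nat \<Rightarrow> nat) \<Rightarrow> (nat \<Rightarrow> real) \<Rightarrow> nat \<Rightarrow> nat \<Rightarrow> nat" where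
  "hired s x n c = (LEAST k. c \<le> k \<and> (best_in s x {1..k} k \<or> k = n))"

(* V_n(c), for c in {1..n}: expectation over the tie-breaking permutation and over the qualities. *)

definition threshold_value :: "'a measure \<Rightarrow> nat \<Rightarrow> (nat \<Rightarrow> 'a \<Rightarrow> real) \<Rightarrow> nat \<Rightarrow> real" where
  "threshold_value M n X c =
     (\<Sum>s | s permutes {1..n}. \<integral>\<omega>. X (hired s (\<lambda>k. X k \<omega>) n c) \<omega> \<partial>M) / fact n"

definition optimal_threshold :: "'a measure \<Rightarrow> nat \<Rightarrow> (nat \<Rightarrow> 'a \<Rightarrow> real) \<Rightarrow> nat" where
  "optimal_threshold M n X =
     (LEAST c. c \<in> {1..n} \<and> (\<forall>d\<in>{1..n}. threshold_value M n X d \<le> threshold_value M n X c))"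


lemma worse_asym: "worse s x j k \<Longrightarrow> \<not> worse s x k j"
  by (auto simp: worse_def)

lemma worse_trans: "worse s x i j \<Longrightarrow> worse s x j k \<Longrightarrow> worse s x i k"
  by (auto simp: worse_def)

lemma best_in_unique: "best_in s x S i \<Longrightarrow> best_in s x S j \<Longrightarrow> i = j"
  unfolding best_in_def using worse_asym by (metis DiffI singletonD)

lemma best_in_exists:
  assumes "finite S" "S \<noteq> {}" "inj_on s S"
  shows "\<exists>k. best_in s x S k"
  using assms
proof (induction S rule: finite_ne_induct)
  case (singleton a)
  then show ?case by (auto simp: best_in_def)
next
  case (insert a F)
  then obtain k where k: "best_in s x F k" by auto
  then have "k \<in> F" by (auto simp: best_in_def)
  with insert have "k \<noteq> a" "s k \<noteq> s a" by (auto simp: inj_on_def)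
  then consider "worse s x a k" | "worse s x k a"
    by (metis worse_def linorder_neqE)
  then show ?case
  proof cases
    case 1
    then have "best_in s x (insert a F) k" using k by (auto simp: best_in_def)
    then show ?thesis ..
  next
    case 2
    have "worse s x j a" if "j \<in> F" for j
      using 2 k that worse_trans[of s x j k a] by (cases "j = k") (auto simp: best_in_def)
    then have "best_in s x (insert a F) a" by (auto simp: best_in_def)
    then show ?thesis ..
  qed
qed

lemma best_in_comp:
  assumes "inj p"
  shows "best_in (s \<circ> p) (x \<circ> p) S k \<longleftrightarrow> best_in s x (p ` S) (p k)"
  using assms by (auto simp: best_in_def worse_def inj_def)

lemma best_in_subset: "best_in s x S k \<Longrightarrow> T \<subseteq> S \<Longrightarrow> k \<in> T \<Longrightarrow> best_in s x T k"
  by (auto simp: best_in_def)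

lemma best_in_cong: "(\<And>i. i \<in> S \<Longrightarrow> x i = y i) \<Longrightarrow> best_in s x S k \<longleftrightarrow> best_in s y S k"
  by (auto simp: best_in_def worse_def)

lemma best_in_Max:
  assumes "finite S" "best_in s x S k"
  shows "Max (x ` S) = x k"
proof (rule Max_eqI)
  show "x k \<in> x ` S" using assms by (auto simp: best_in_def)
  fix y assume "y \<in> x ` S"
  then obtain j where j: "j \<in> S" "y = x j" by auto
  then have "j = k \<or> worse s x j k" using assms by (auto simp: best_in_def)
  then show "y \<le> x k" using j by (auto simp: worse_def)
qed (use assms in auto)

lemma no_record_iff:
  assumes "inj_on s {1..m}" "2 \<le> c" "c \<le> Suc m"
  shows "(\<forall>i\<in>{c..m}. \<not> best_in s x {1..i} i) \<longleftrightarrow> (\<exists>j\<in>{1..<c}. best_in s x {1..m} j)"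
proof
  assume *: "\<forall>i\<in>{c..m}. \<not> best_in s x {1..i} i"
  have "{1..m} \<noteq> {}" using assms by auto
  then obtain j where j: "best_in s x {1..m} j"
    using best_in_exists[of "{1..m}" s x] assms by auto
  then have "j \<in> {1..m}" by (auto simp: best_in_def)
  then have "best_in s x {1..j} j" using best_in_subset[OF j, of "{1..j}"] by auto
  with * \<open>j \<in> {1..m}\<close> j show "\<exists>j\<in>{1..<c}. best_in s x {1..m} j" by (metis atLeastAtMost_iff atLeastLessThan_iff not_less)
next
  assume "\<exists>j\<in>{1..<c}. best_in s x {1..m} j"
  then obtain j where j: "j \<in> {1..<c}" "best_in s x {1..m} j" by auto
  show "\<forall>i\<in>{c..m}. \<not> best_in s x {1..i} i"
  proof (intro ballI notI)
    fix i assume i: "i \<in> {c..m}" "best_in s x {1..i} i"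
    have "best_in s x {1..i} j" using best_in_subset[OF j(2), of "{1..i}"] i j by auto
    with i have "i = j" by (metis best_in_unique)
    with i j show False by auto
  qed
qed

lemma hired_eq_iff:
  assumes "c \<le> n"
  shows "hired s x n c = k \<longleftrightarrow> c \<le> k \<and> k \<le> n \<and> (best_in s x {1..k} k \<or> k = n) \<and>
           (\<forall>i\<in>{c..<k}. \<not> best_in s x {1..i} i)"
proof -
  let ?P = "\<lambda>k. c \<le> k \<and> (best_in s x {1..k} k \<or> k = n)"
  have "?P n" using assms by auto
  have h: "?P (hired s x n c)" unfolding hired_def by (rule LeastI[of ?P, OF \<open>?P n\<close>])
  have le: "hired s x n c \<le> i" if "?P i" for i unfolding hired_def using that by (rule Least_le)
  show ?thesis
  proof
    assume k: "hired s x n c = k"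
    have "k \<le> n" using le[OF \<open>?P n\<close>] k by auto
    moreover have "\<forall>i\<in>{c..<k}. \<not> best_in s x {1..i} i" using le k by fastforce
    ultimately show "c \<le> k \<and> k \<le> n \<and> (best_in s x {1..k} k \<or> k = n) \<and>
           (\<forall>i\<in>{c..<k}. \<not> best_in s x {1..i} i)" using h k by auto
  next
    assume a: "c \<le> k \<and> k \<le> n \<and> (best_in s x {1..k} k \<or> k = n) \<and>
           (\<forall>i\<in>{c..<k}. \<not> best_in s x {1..i} i)"
    then have "hired s x n c \<le> k" using le by auto
    moreover have "\<not> hired s x n c < k" using h a by auto
    ultimately show "hired s x n c = k" by auto
  qed
qed

definition top_two :: "(nat \<Rightarrow> nat) \<Rightarrow> (nat \<Rightarrow> real) \<Rightarrow> nat \<Rightarrow> nat \<Rightarrow> nat \<Rightarrow> bool" where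
  "top_two s x k i j \<longleftrightarrow> best_in s x {1..k} i \<and> best_in s x ({1..k} - {i}) j"

lemma quality_hired:
  assumes c: "2 \<le> c" "c \<le> n" and s: "inj_on s {1..n}"
  shows "x (hired s x n c) =
     (\<Sum>k\<in>{c..<n}. \<Sum>j\<in>{1..<c}. of_bool (top_two s x k k j) * Max (x ` {1..k})) +
     (\<Sum>j\<in>{1..<c}. of_bool (best_in s x {1..n-1} j) * x n)"
proof -
  have sumb: "(\<Sum>j\<in>{1..<c}. of_bool (Q \<and> best_in s x S j) * (z::real)) =
        of_bool (Q \<and> (\<exists>j\<in>{1..<c}. best_in s x S j)) * z" for Q S z
  proof (cases "Q \<and> (\<exists>j\<in>{1..<c}. best_in s x S j)")
    case True
    then obtain j where j: "j \<in> {1..<c}" "best_in s x S j" by auto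
    have "Q \<and> best_in s x S i \<longleftrightarrow> i = j" for i using j True best_in_unique by metis
    then have "(\<Sum>i\<in>{1..<c}. of_bool (Q \<and> best_in s x S i) * z) = (\<Sum>i\<in>{1..<c}. if i = j then z else 0)"
      by (intro sum.cong) auto
    also have "\<dots> = z" using j(1) by (simp del: One_nat_def)
    finally show ?thesis using True by (simp del: One_nat_def)
  qed auto
  have inj: "inj_on s {1..m}" if "m \<le> n" for m
    using s by (rule inj_on_subset) (use that in auto)
  have 1: "hired s x n c = k \<longleftrightarrow> best_in s x {1..k} k \<and> (\<exists>j\<in>{1..<c}. best_in s x ({1..k} - {k}) j)"
    if k: "k \<in> {c..<n}" for k
  proof -
    have e: "{1..k} - {k} = {1..k-1}" "{c..<k} = {c..k-1}" using k c by auto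
    show ?thesis unfolding e hired_eq_iff[OF c(2)]
      using no_record_iff[of s "k-1" c x] inj[of "k-1"] k c by auto
  qed
  have 2: "hired s x n c = n \<longleftrightarrow> (\<exists>j\<in>{1..<c}. best_in s x {1..n-1} j)"
  proof -
    have e: "{c..<n} = {c..n-1}" using c by auto
    show ?thesis unfolding e hired_eq_iff[OF c(2)]
      using no_record_iff[of s "n-1" c x] inj[of "n-1"] c by auto
  qed
  have A: "(\<Sum>j\<in>{1..<c}. of_bool (top_two s x k k j) * Max (x ` {1..k})) =
       (if hired s x n c = k then x k else 0)" if k: "k \<in> {c..<n}" for k
    unfolding top_two_def sumb 1[OF k, symmetric] using 1[OF k] best_in_Max[of "{1..k}" s x k] by auto
  have B: "(\<Sum>j\<in>{1..<c}. of_bool (best_in s x {1..n-1} j) * x n) = (if hired s x n c = n then x n else 0)"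
    using sumb[of True "{1..n-1}" "x n"] unfolding simp_thms 2[symmetric]
    by (cases "hired s x n c = n") (simp_all only: of_bool_eq simp_thms if_True if_False mult_1 mult_zero_left)
  have "hired s x n c \<in> {c..n}" using hired_eq_iff[OF c(2), of s x] by auto
  then show ?thesis unfolding B using A by (auto simp: sum.delta)
qed

lemma exchangeable_sum_eq:
  assumes ex: "exchangeable M n X" and p: "p permutes {1..n}"
    and meas: "\<And>s. G s \<in> borel_measurable (PiM {1..n} (\<lambda>_. borel :: real measure))"
    and loc: "\<And>s x. G s (restrict x {1..n}) = G s x"
  shows "(\<Sum>s | s permutes {1..n}. \<integral>\<omega>. G (s \<circ> p) ((\<lambda>k. X k \<omega>) \<circ> p) \<partial>M) =
         (\<Sum>s | s permutes {1..n}. \<integral>\<omega>. (G s (\<lambda>k. X k \<omega>) :: real) \<partial>M)"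
proof -
  let ?N = "PiM {1..n} (\<lambda>_. borel :: real measure)"
  have X: "X k \<in> borel_measurable M" if "k \<in> {1..n}" for k
    using ex that by (auto simp: exchangeable_def)
  have tr: "(\<integral>\<omega>. G s (\<lambda>k. X (q k) \<omega>) \<partial>M) = (\<integral>y. G s y \<partial>distr M ?N (\<lambda>\<omega>. \<lambda>k\<in>{1..n}. X (q k) \<omega>))"
    if q: "q permutes {1..n}" for s q
  proof -
    have "(\<lambda>\<omega>. \<lambda>k\<in>{1..n}. X (q k) \<omega>) \<in> M \<rightarrow>\<^sub>M ?N"
      by (intro measurable_restrict X) (use permutes_in_image[OF q] in auto)
    moreover have "G s (\<lambda>k. X (q k) \<omega>) = G s (\<lambda>k\<in>{1..n}. X (q k) \<omega>)" for \<omega>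
      by (rule loc[symmetric])
    ultimately show ?thesis by (simp add: integral_distr[OF _ meas] del: One_nat_def)
  qed
  have "(\<integral>\<omega>. G s (\<lambda>k. X (p k) \<omega>) \<partial>M) = (\<integral>\<omega>. G s (\<lambda>k. X k \<omega>) \<partial>M)" for s
    using tr[OF p] tr[OF permutes_id] ex p by (simp add: exchangeable_def)
  then have "(\<Sum>s | s permutes {1..n}. \<integral>\<omega>. G (s \<circ> p) ((\<lambda>k. X k \<omega>) \<circ> p) \<partial>M) =
     (\<Sum>s | s permutes {1..n}. \<integral>\<omega>. G (s \<circ> p) (\<lambda>k. X k \<omega>) \<partial>M)"
    by (simp add: o_def)
  also have "\<dots> = (\<Sum>s | s permutes {1..n}. \<integral>\<omega>. G s (\<lambda>k. X k \<omega>) \<partial>M)"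
    using sum_permutations_compose_right[OF p, of "\<lambda>s. \<integral>\<omega>. G s (\<lambda>k. X k \<omega>) \<partial>M"] by simp
  finally show ?thesis .
qed


lemma threshold_value_eq:
  assumes M: "prob_space M" and ex: "exchangeable M n X"
    and int: "\<And>k. k \<in> {1..n} \<Longrightarrow> integrable M (X k)"
    and c: "2 \<le> c" "c \<le> n"
  shows "threshold_value M n X c =
    (\<Sum>k=c..n-1. expected_max M X k * (real (c - 1) / real (k - 1)) * (1 / real k)) +
    real (c - 1) / real (n - 1) * (\<integral>\<omega>. X 1 \<omega> \<partial>M)"
proof -
  interpret prob_space M by fact
  let ?N = "PiM {1..n} (\<lambda>_. borel :: real measure)"
  define P where "P = {s. s permutes {1..n}}"
  define Y where "Y \<omega> = (\<lambda>k. X k \<omega>)" for \<omega>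
  define E where "E G = (\<Sum>s\<in>P. \<integral>\<omega>. G s (Y \<omega>) \<partial>M)" for G :: "(nat \<Rightarrow> nat) \<Rightarrow> (nat \<Rightarrow> real) \<Rightarrow> real"
  have finP: "finite P" and cardP: "card P = fact n"
    unfolding P_def by (auto simp: finite_permutations card_permutations)
  have injP: "inj_on s S" if "s \<in> P" for s S
    using that permutes_inj by (auto simp: P_def intro: inj_on_subset)
  have Xm: "X k \<in> borel_measurable M" if "k \<in> {1..n}" for k
    using int[OF that] by auto
  have cmp: "(\<lambda>x. x k) \<in> borel_measurable ?N" if "k \<in> {1..n}" for k
    using that by measurable
  have pm: "Measurable.pred ?N (\<lambda>x. f x < g x \<or> f x = g x \<and> b)"
    if [measurable]: "f \<in> borel_measurable ?N" "g \<in> borel_measurable ?N"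
    for f g :: "(nat \<Rightarrow> real) \<Rightarrow> real" and b
  proof (cases b)
    case True
    have "Measurable.pred ?N (\<lambda>x. \<not> g x < f x)" by measurable
    with True show ?thesis by (simp add: not_less le_less)
  next
    case False
    have "Measurable.pred ?N (\<lambda>x. f x < g x)" by measurable
    with False show ?thesis by simp
  qed
  have bm: "Measurable.pred ?N (\<lambda>x. best_in s x S k)" if S: "S \<subseteq> {1..n}" for s S k
  proof (cases "k \<in> S")
    case True
    have f: "finite S" using S finite_subset by auto
    have ck: "(\<lambda>x. x k) \<in> borel_measurable ?N" using True S by (intro cmp) auto
    have "Measurable.pred ?N (\<lambda>x. worse s x j k)" if "j \<in> S - {k}" for j
    proof -
      have cj: "(\<lambda>x. x j) \<in> borel_measurable ?N" using that S by (intro cmp) auto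
      show ?thesis unfolding worse_def by (rule pm[OF cj ck])
    qed
    then have "Measurable.pred ?N (\<lambda>x. \<forall>j\<in>S - {k}. worse s x j k)"
      using f by (intro pred_intros_finite) auto
    then show ?thesis using True unfolding best_in_def by simp
  qed (auto simp: best_in_def)
  have Mm: "(\<lambda>x. Max (x ` {1..k})) \<in> borel_measurable ?N" if "k \<le> n" for k
    using that by (intro borel_measurable_Max cmp) auto
  have Ym: "(\<lambda>\<omega>. restrict (Y \<omega>) {1..n}) \<in> M \<rightarrow>\<^sub>M ?N"
    unfolding Y_def by (intro measurable_restrict Xm)
  have bmM: "Measurable.pred M (\<lambda>\<omega>. best_in s (Y \<omega>) S k)" if S: "S \<subseteq> {1..n}" for s S k
  proof -
    have "best_in s (Y \<omega>) S k = best_in s (restrict (Y \<omega>) {1..n}) S k" for \<omega>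
      using S by (intro best_in_cong) auto
    then show ?thesis using measurable_compose[OF Ym bm[OF S]] by simp
  qed
  have im: "Max (restrict x {1..n} ` {1..k}) = Max (x ` {1..k})" if "k \<le> n" for x :: "nat \<Rightarrow> real" and k
    using that by (intro arg_cong[of _ _ Max] image_cong) auto
  have intMax: "integrable M (\<lambda>\<omega>. Max (Y \<omega> ` {1..k}))" if k: "1 \<le> k" "k \<le> n" for k
  proof (rule Bochner_Integration.integrable_bound)
    show "integrable M (\<lambda>\<omega>. \<Sum>i\<in>{1..k}. \<bar>X i \<omega>\<bar>)"
      using k int by (intro Bochner_Integration.integrable_sum integrable_abs) auto
    show "(\<lambda>\<omega>. Max (Y \<omega> ` {1..k})) \<in> borel_measurable M"
      unfolding Y_def using k by (intro borel_measurable_Max Xm) auto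
    have "\<bar>Max (Y \<omega> ` {1..k})\<bar> \<le> (\<Sum>i\<in>{1..k}. \<bar>X i \<omega>\<bar>)" for \<omega>
    proof -
      have "Max (Y \<omega> ` {1..k}) \<in> Y \<omega> ` {1..k}" using k by (intro Max_in) auto
      then obtain i where "i \<in> {1..k}" "Max (Y \<omega> ` {1..k}) = X i \<omega>" by (auto simp: Y_def)
      then show ?thesis using member_le_sum[of i "{1..k}" "\<lambda>i. \<bar>X i \<omega>\<bar>"] by auto
    qed
    then show "AE \<omega> in M. norm (Max (Y \<omega> ` {1..k})) \<le> norm (\<Sum>i\<in>{1..k}. \<bar>X i \<omega>\<bar>)"
      by (auto simp: sum_nonneg)
  qed
  have intB: "integrable M (\<lambda>\<omega>. of_bool (Q \<omega>) * f \<omega> :: real)"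
    if "integrable M f" "Measurable.pred M Q" for Q f
  proof -
    have "integrable M (\<lambda>\<omega>. indicator {\<omega>\<in>space M. Q \<omega>} \<omega> *\<^sub>R f \<omega>)"
      using that by (intro integrable_mult_indicator) auto
    moreover have "integrable M (\<lambda>\<omega>. indicator {\<omega>\<in>space M. Q \<omega>} \<omega> *\<^sub>R f \<omega>) \<longleftrightarrow>
        integrable M (\<lambda>\<omega>. of_bool (Q \<omega>) * f \<omega>)"
      by (rule Bochner_Integration.integrable_cong[OF refl]) (auto simp: indicator_def)
    ultimately show ?thesis by blast
  qed

  \<comment> \<open>The maximum of the first k, on the event that i is best and j second best among them\<close>
  define T where "T k i j = (\<lambda>s x. of_bool (top_two s x k i j) * Max (x ` {1..k}))"
    for k i j and x :: "nat \<Rightarrow> real" and s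
  have Tint: "integrable M (\<lambda>\<omega>. T k i j s (Y \<omega>))" if "1 \<le> k" "k \<le> n" for k i j s
  proof -
    have "Measurable.pred M (\<lambda>\<omega>. top_two s (Y \<omega>) k i j)"
      unfolding top_two_def using that by (intro pred_intros_logic bmM) auto
    then show ?thesis unfolding T_def using intMax that by (intro intB) auto
  qed
  have Tmeas: "T k i j s \<in> borel_measurable ?N" if "k \<le> n" for k i j s
  proof -
    have "Measurable.pred ?N (\<lambda>x. top_two s x k i j)"
      unfolding top_two_def using that by (intro pred_intros_logic bm) auto
    then show ?thesis unfolding T_def of_bool_def using Mm[OF that]
      by (intro borel_measurable_times measurable_If) auto
  qed
  have Tloc: "T k i j s (restrict x {1..n}) = T k i j s x" if "k \<le> n" for k i j s x
  proof -
    have "top_two s (restrict x {1..n}) k i j = top_two s x k i j"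
      unfolding top_two_def using that by (intro arg_cong2[of _ _ _ _ "(\<and>)"] best_in_cong) auto
    then show ?thesis unfolding T_def im[OF that] by simp
  qed
  have Teq: "E (T k i j) = E (T k i' j')"
    if k: "k \<le> n" and ij: "i \<in> {1..k}" "j \<in> {1..k}" "i \<noteq> j" and ij': "i' \<in> {1..k}" "j' \<in> {1..k}" "i' \<noteq> j'"
    for k i j i' j'
  proof -
    define p where "p = Transposition.transpose (Transposition.transpose i i' j) j' \<circ> Transposition.transpose i i'"
    have "Transposition.transpose i i' j \<in> {1..k}" using ij ij' by (auto simp: Transposition.transpose_def)
    then have pk: "p permutes {1..k}" unfolding p_def using ij ij'
      by (intro permutes_compose permutes_swap_id)
    then have pn: "p permutes {1..n}" by (rule permutes_subset) (use k in auto)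
    have pi: "p i = i'" "p j = j'" using ij ij' by (auto simp: p_def Transposition.transpose_def)
    have inj: "inj p" using pk permutes_inj by auto
    have img: "p ` {1..k} = {1..k}" using pk permutes_image by auto
    have img2: "p ` ({1..k} - {i}) = {1..k} - {i'}"
      using img pi inj by (simp add: image_set_diff)
    have "T k i j (s \<circ> p) (x \<circ> p) = T k i' j' s x" for s x
    proof -
      have "(x \<circ> p) ` {1..k} = x ` {1..k}" using img by (metis image_comp)
      then show ?thesis unfolding T_def top_two_def best_in_comp[OF inj] img img2 pi by simp
    qed
    then show ?thesis
      using exchangeable_sum_eq[OF ex pn, of "T k i j"] Tmeas[OF k] Tloc[OF k]
      by (simp add: E_def P_def Y_def)
  qed
  have Tval: "E (T k k j) = fact n * expected_max M X k / (real k * real (k - 1))"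
    if k: "2 \<le> k" "k \<le> n" and j: "j \<in> {1..<k}" for k j
  proof -
    define D where "D = (SIGMA i:{1..k}. {1..k} - {i})"
    have "card D = (\<Sum>i\<in>{1..k}. k - 1)" unfolding D_def by (subst card_SigmaI) auto
    then have cD: "real (card D) = real k * real (k - 1)" by simp
    have one: "(\<Sum>(i,j)\<in>D. T k i j s x) = Max (x ` {1..k})" if s: "s \<in> P" for s x
    proof -
      obtain a where a: "best_in s x {1..k} a" using best_in_exists[of "{1..k}" s x] injP[OF s] k by auto
      then have aS: "a \<in> {1..k}" by (auto simp: best_in_def)
      have "1 \<in> {1..k} - {a} \<or> 2 \<in> {1..k} - {a}" using k by auto
      then have "{1..k} - {a} \<noteq> {}" by blast
      then obtain b where b: "best_in s x ({1..k} - {a}) b"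
        using best_in_exists[of "{1..k} - {a}" s x] injP[OF s] by auto
      then have bS: "b \<in> {1..k} - {a}" by (auto simp: best_in_def)
      have "top_two s x k i j \<longleftrightarrow> (i, j) = (a, b)" for i j
        unfolding top_two_def using a b best_in_unique by (metis prod.inject)
      then have "(\<Sum>(i,j)\<in>D. T k i j s x) = (\<Sum>d\<in>D. if d = (a,b) then Max (x ` {1..k}) else 0)"
        by (intro sum.cong) (auto simp: T_def)
      also have "\<dots> = Max (x ` {1..k})" using aS bS unfolding D_def by (subst sum.delta) auto
      finally show ?thesis .
    qed
    have "real (card D) * E (T k k j) = (\<Sum>d\<in>D. E (T k (fst d) (snd d)))"
    proof -
      have "E (T k (fst d) (snd d)) = E (T k k j)" if "d \<in> D" for d
        using that k j by (intro Teq) (auto simp: D_def)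
      then show ?thesis by simp
    qed
    also have "\<dots> = (\<Sum>s\<in>P. \<Sum>d\<in>D. \<integral>\<omega>. T k (fst d) (snd d) s (Y \<omega>) \<partial>M)"
      unfolding E_def by (rule sum.swap)
    also have "\<dots> = (\<Sum>s\<in>P. \<integral>\<omega>. (\<Sum>d\<in>D. T k (fst d) (snd d) s (Y \<omega>)) \<partial>M)"
      using Tint k by (intro sum.cong refl Bochner_Integration.integral_sum[symmetric]) auto
    also have "\<dots> = (\<Sum>s\<in>P. \<integral>\<omega>. Max (Y \<omega> ` {1..k}) \<partial>M)"
      using one by (intro sum.cong refl) (simp add: case_prod_unfold)
    also have "\<dots> = fact n * expected_max M X k"
      by (simp add: cardP expected_max_def Y_def)
    finally show ?thesis using k unfolding cD by (simp add: field_simps)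
  qed

  \<comment> \<open>The last quality, on the event that j is best among the first n - 1\<close>
  define L where "L j = (\<lambda>s x. of_bool (best_in s x {1..n-1} j) * x n)" for j and x :: "nat \<Rightarrow> real" and s
  have n: "n \<in> {1..n}" using c by auto
  have Lint: "integrable M (\<lambda>\<omega>. L j s (Y \<omega>))" for j s
  proof -
    have "integrable M (\<lambda>\<omega>. Y \<omega> n)" using int[OF n] by (simp add: Y_def)
    then show ?thesis unfolding L_def by (intro intB bmM) auto
  qed
  have Lmeas: "L j s \<in> borel_measurable ?N" for j s
    unfolding L_def of_bool_def using cmp[OF n] bm[of "{1..n-1}" s j]
    by (intro borel_measurable_times measurable_If) auto
  have Lloc: "L j s (restrict x {1..n}) = L j s x" for j s x
  proof -
    have "best_in s (restrict x {1..n}) {1..n-1} j = best_in s x {1..n-1} j" by (intro best_in_cong) auto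
    then show ?thesis unfolding L_def using n by simp
  qed
  have Leq: "E (L i) = E (L j)" if ij: "i \<in> {1..n-1}" "j \<in> {1..n-1}" for i j
  proof -
    define p where "p = Transposition.transpose i j"
    have pk: "p permutes {1..n-1}" unfolding p_def using ij by (intro permutes_swap_id)
    then have pn: "p permutes {1..n}" by (rule permutes_subset) auto
    have pi: "p i = j" by (auto simp: p_def)
    have "n \<notin> {1..n-1}" using n by auto
    then have pnn: "p n = n" using pk by (rule permutes_not_in[rotated])
    have inj: "inj p" using pk permutes_inj by auto
    have img: "p ` {1..n-1} = {1..n-1}" using pk permutes_image by auto
    have "L i (s \<circ> p) (x \<circ> p) = L j s x" for s x
      unfolding L_def best_in_comp[OF inj] img pi by (simp add: pnn)
    then show ?thesis
      using exchangeable_sum_eq[OF ex pn, of "L i"] Lmeas Lloc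
      by (simp add: E_def P_def Y_def)
  qed
  have Xn: "E (\<lambda>s x. x n) = E (\<lambda>s x. x 1)"
  proof -
    have pn: "Transposition.transpose 1 n permutes {1..n}" using n by (intro permutes_swap_id) auto
    have "1 \<in> {1..n}" using n by auto
    then show ?thesis
      using exchangeable_sum_eq[OF ex pn, of "\<lambda>s x. x 1"] cmp[of 1]
      by (simp add: E_def P_def Y_def)
  qed
  have Lval: "E (L j) = fact n * (\<integral>\<omega>. X 1 \<omega> \<partial>M) / real (n - 1)" if j: "j \<in> {1..n-1}" for j
  proof -
    have one: "(\<Sum>i\<in>{1..n-1}. L i s x) = x n" if s: "s \<in> P" for s x
    proof -
      obtain a where a: "best_in s x {1..n-1} a"
        using best_in_exists[of "{1..n-1}" s x] injP[OF s] j by auto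
      then have aS: "a \<in> {1..n-1}" by (auto simp: best_in_def)
      have "best_in s x {1..n-1} i \<longleftrightarrow> i = a" for i using a best_in_unique by metis
      then have "(\<Sum>i\<in>{1..n-1}. L i s x) = (\<Sum>i\<in>{1..n-1}. if i = a then x n else 0)"
        unfolding L_def by (intro sum.cong) auto
      then show ?thesis using aS by (simp del: One_nat_def)
    qed
    have "real (n - 1) * E (L j) = (\<Sum>i\<in>{1..n-1}. E (L i))"
    proof -
      have "E (L i) = E (L j)" if "i \<in> {1..n-1}" for i using that j by (intro Leq)
      then show ?thesis by (simp del: One_nat_def)
    qed
    also have "\<dots> = (\<Sum>s\<in>P. \<Sum>i\<in>{1..n-1}. \<integral>\<omega>. L i s (Y \<omega>) \<partial>M)"
      unfolding E_def by (rule sum.swap)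
    also have "\<dots> = (\<Sum>s\<in>P. \<integral>\<omega>. (\<Sum>i\<in>{1..n-1}. L i s (Y \<omega>)) \<partial>M)"
      using Lint by (intro sum.cong refl Bochner_Integration.integral_sum[symmetric]) auto
    also have "\<dots> = E (\<lambda>s x. x n)" unfolding E_def using one by (intro sum.cong refl) simp
    also have "\<dots> = fact n * (\<integral>\<omega>. X 1 \<omega> \<partial>M)" unfolding Xn by (simp add: E_def cardP Y_def)
    finally have "real (n - 1) * E (L j) = fact n * (\<integral>\<omega>. X 1 \<omega> \<partial>M)" .
    moreover have "real (n - 1) \<noteq> 0" using j by auto
    ultimately show ?thesis by (metis nonzero_mult_div_cancel_left)
  qed

  have "(\<Sum>s\<in>P. \<integral>\<omega>. Y \<omega> (hired s (Y \<omega>) n c) \<partial>M) =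
      (\<Sum>s\<in>P. (\<Sum>k\<in>{c..<n}. \<Sum>j\<in>{1..<c}. \<integral>\<omega>. T k k j s (Y \<omega>) \<partial>M) + (\<Sum>j\<in>{1..<c}. \<integral>\<omega>. L j s (Y \<omega>) \<partial>M))"
  proof (rule sum.cong[OF refl])
    fix s assume s: "s \<in> P"
    have "(\<integral>\<omega>. Y \<omega> (hired s (Y \<omega>) n c) \<partial>M) =
        (\<integral>\<omega>. (\<Sum>k\<in>{c..<n}. \<Sum>j\<in>{1..<c}. T k k j s (Y \<omega>)) + (\<Sum>j\<in>{1..<c}. L j s (Y \<omega>)) \<partial>M)"
      unfolding T_def L_def using quality_hired[OF c injP[OF s]] by simp
    also have "\<dots> = (\<integral>\<omega>. (\<Sum>k\<in>{c..<n}. \<Sum>j\<in>{1..<c}. T k k j s (Y \<omega>)) \<partial>M) + (\<integral>\<omega>. (\<Sum>j\<in>{1..<c}. L j s (Y \<omega>)) \<partial>M)"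
      using c Tint Lint by (intro Bochner_Integration.integral_add Bochner_Integration.integrable_sum) auto
    also have "(\<integral>\<omega>. (\<Sum>j\<in>{1..<c}. L j s (Y \<omega>)) \<partial>M) = (\<Sum>j\<in>{1..<c}. \<integral>\<omega>. L j s (Y \<omega>) \<partial>M)"
      using Lint by (intro Bochner_Integration.integral_sum) auto
    also have "(\<integral>\<omega>. (\<Sum>k\<in>{c..<n}. \<Sum>j\<in>{1..<c}. T k k j s (Y \<omega>)) \<partial>M) =
        (\<Sum>k\<in>{c..<n}. \<integral>\<omega>. (\<Sum>j\<in>{1..<c}. T k k j s (Y \<omega>)) \<partial>M)"
      using c Tint by (intro Bochner_Integration.integral_sum Bochner_Integration.integrable_sum) auto
    also have "\<dots> = (\<Sum>k\<in>{c..<n}. \<Sum>j\<in>{1..<c}. \<integral>\<omega>. T k k j s (Y \<omega>) \<partial>M)"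
      using c Tint by (intro sum.cong refl Bochner_Integration.integral_sum) auto
    finally show "(\<integral>\<omega>. Y \<omega> (hired s (Y \<omega>) n c) \<partial>M) =
      (\<Sum>k\<in>{c..<n}. \<Sum>j\<in>{1..<c}. \<integral>\<omega>. T k k j s (Y \<omega>) \<partial>M) + (\<Sum>j\<in>{1..<c}. \<integral>\<omega>. L j s (Y \<omega>) \<partial>M)" .
  qed
  also have "\<dots> = (\<Sum>k\<in>{c..<n}. \<Sum>j\<in>{1..<c}. E (T k k j)) + (\<Sum>j\<in>{1..<c}. E (L j))"
    unfolding sum.distrib E_def
    by (subst (1) sum.swap, subst (2) sum.swap, subst (4) sum.swap) (rule refl)
  also have "(\<Sum>k\<in>{c..<n}. \<Sum>j\<in>{1..<c}. E (T k k j)) =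
      (\<Sum>k\<in>{c..<n}. \<Sum>j\<in>{1..<c}. fact n * expected_max M X k / (real k * real (k - 1)))"
    using c by (intro sum.cong refl Tval) auto
  also have "(\<Sum>j\<in>{1..<c}. E (L j)) = (\<Sum>j\<in>{1..<c}. fact n * (\<integral>\<omega>. X 1 \<omega> \<partial>M) / real (n - 1))"
    using c by (intro sum.cong refl Lval) auto
  finally have "threshold_value M n X c =
     (\<Sum>k\<in>{c..<n}. real (c - 1) * (fact n * expected_max M X k / (real k * real (k - 1)))) / fact n +
     real (c - 1) * (fact n * (\<integral>\<omega>. X 1 \<omega> \<partial>M) / real (n - 1)) / fact n"
    unfolding threshold_value_def by (simp only: P_def Y_def add_divide_distrib sum_constant card_atLeastLessThan)
  also have "(\<Sum>k\<in>{c..<n}. real (c - 1) * (fact n * expected_max M X k / (real k * real (k - 1)))) / fact n =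
     (\<Sum>k\<in>{c..<n}. expected_max M X k * (real (c - 1) / real (k - 1)) * (1 / real k))"
    unfolding sum_divide_distrib by (intro sum.cong) (auto simp: mult.commute)
  also have "{c..<n} = {c..n-1}" using c by auto
  finally show ?thesis by simp
qed

lemma threshold_value_1: "1 \<le> n \<Longrightarrow> threshold_value M n X 1 = (\<integral>\<omega>. X 1 \<omega> \<partial>M)"
proof -
  assume n: "1 \<le> n"
  have "hired s x n 1 = 1" for s x using n by (subst hired_eq_iff) (auto simp: best_in_def)
  then show ?thesis by (simp add: threshold_value_def card_permutations[OF refl])
qed

end

theory Submission
  imports Defs
begin

text \<open>Write \<open>\<mu>\<^sub>k\<close> for the expected maximum of the first \<open>k\<close> qualities. By exchangeability \<open>k \<mapsto> \<mu>\<^sub>k\<close> is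
  concave, hence \<open>(\<mu>\<^sub>k - \<mu>\<^sub>1) / (k - 1)\<close> is nonincreasing. The weights in the formula for \<open>V\<^sub>n(c)\<close> sum
  to 1, so \<open>V\<^sub>n(c) - \<mu>\<^sub>1\<close> is \<open>c - 1\<close> times the sum of \<open>(\<mu>\<^sub>k - \<mu>\<^sub>1) / (k (k - 1))\<close> over \<open>c \<le> k < n\<close>.
  Minimality of the optimal \<open>c\<close> gives \<open>V\<^sub>n(c) > V\<^sub>n(c - 1)\<close>, which bounds that sum from below by
  \<open>(\<mu>\<^sub>m - \<mu>\<^sub>1) / m\<close> with \<open>m = c - 1\<close>; concavity bounds it from above by
  \<open>(\<mu>\<^sub>m - \<mu>\<^sub>1) / (m - 1)\<close> times the sum of \<open>1 / k\<close> over \<open>m < k < n\<close>. Comparing the two gives the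
  harmonic inequality, and comparing the harmonic sum with a logarithm gives the asymptotics.\<close>

section \<open>Chord slopes of concave sequences\<close>

lemma concave_seq_slope_antimono:
  fixes f :: "nat \<Rightarrow> real"
  assumes concave: "\<And>k. k + 2 \<le> N \<Longrightarrow> f (k + 2) - f (k + 1) \<le> f (k + 1) - f k"
    and "1 \<le> m" "m \<le> k" "k \<le> N"
  shows "(f k - f 0) / k \<le> (f m - f 0) / m"
proof -
  \<comment> \<open>The next increment is at most the mean of the \<open>j\<close> earlier ones;
    this is what makes the chord from 0 flatter at \<open>Suc j\<close> than at
    \<open>j\<close>.\<close>
  have slope: "real j * (f (Suc j) - f j) \<le> f j - f 0" if "Suc j \<le> N" for j
    using that
  proof (induction j)
    case (Suc j)
    have "real (Suc j) * (f (Suc (Suc j)) - f (Suc j)) \<le> real (Suc j) * (f (Suc j) - f j)"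
      using concave[of j] Suc.prems by (intro mult_left_mono) auto
    with Suc show ?case by (simp add: algebra_simps)
  qed simp
  show ?thesis
    using \<open>m \<le> k\<close> \<open>k \<le> N\<close>
  proof (induction k rule: dec_induct)
    case (step j)
    have "(f (Suc j) - f 0) / Suc j \<le> (f j - f 0) / j"
      using slope[of j] step assms(2)
      by (simp add: field_simps)
    with step show ?case by simp
  qed simp
qed

section \<open>Expected maxima under exchangeability\<close>

lemma integrable_Max:
  fixes X :: "'i \<Rightarrow> 'a \<Rightarrow> real"
  assumes "finite S" "S \<noteq> {}" "\<And>j. j \<in> S \<Longrightarrow> integrable M (X j)"
  shows "integrable M (\<lambda>\<omega>. Max ((\<lambda>j. X j \<omega>) ` S))"
  using assms by (induction S rule: finite_ne_induct) (auto simp: integrable_max)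

text \<open>The maximum is a measurable function of the vector of qualities, so its integral depends
  only on the law of that vector on the product space, which \<open>p\<close> preserves.\<close>

lemma exchangeable_integral_Max:
  assumes ex: "exchangeable M n X" and p: "p permutes {1..n}" and S: "S \<subseteq> {1..n}"
  shows "(\<integral>\<omega>. Max ((\<lambda>j. X j \<omega>) ` p ` S) \<partial>M) = (\<integral>\<omega>. Max ((\<lambda>j. X j \<omega>) ` S) \<partial>M)"
proof -
  let ?N = "PiM {1..n} (\<lambda>_. borel :: real measure)"
  have X: "X k \<in> borel_measurable M" if "k \<in> {1..n}" for k
    using ex that by (auto simp: exchangeable_def)
  have "(\<lambda>x. x k) \<in> borel_measurable ?N" if "k \<in> S" for k
    using that S by (intro measurable_component_singleton) auto
  then have meas: "(\<lambda>x. Max ((\<lambda>j. x j) ` S)) \<in> borel_measurable ?N"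
    using S by (intro borel_measurable_Max) (auto intro: finite_subset)
  have tr: "(\<integral>\<omega>. Max ((\<lambda>j. X (q j) \<omega>) ` S) \<partial>M) =
      (\<integral>x. Max ((\<lambda>j. x j) ` S) \<partial>distr M ?N (\<lambda>\<omega>. \<lambda>k\<in>{1..n}. X (q k) \<omega>))"
    if q: "q permutes {1..n}" for q
  proof -
    have "(\<lambda>\<omega>. \<lambda>k\<in>{1..n}. X (q k) \<omega>) \<in> M \<rightarrow>\<^sub>M ?N"
      by (intro measurable_restrict X) (use permutes_in_image[OF q] in auto)
    moreover have "(\<lambda>j. X (q j) \<omega>) ` S = (\<lambda>j. (\<lambda>k\<in>{1..n}. X (q k) \<omega>) j) ` S" for \<omega>
      using S by (intro image_cong) auto
    ultimately show ?thesis by (simp only: integral_distr[OF _ meas])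
  qed
  have "distr M ?N (\<lambda>\<omega>. \<lambda>k\<in>{1..n}. X (p k) \<omega>) = distr M ?N (\<lambda>\<omega>. \<lambda>k\<in>{1..n}. X k \<omega>)"
    using ex p by (simp add: exchangeable_def)
  then show ?thesis
    using tr[OF p] tr[OF permutes_id] by (simp add: image_image del: One_nat_def)
qed

lemma expected_max_1: "expected_max M X 1 = (\<integral>\<omega>. X 1 \<omega> \<partial>M)"
  by (simp add: expected_max_def)

lemma expected_max_mono:
  assumes int: "\<And>j. j \<in> {1..n} \<Longrightarrow> integrable M (X j)" and k: "1 \<le> j" "j \<le> k" "k \<le> n"
  shows "expected_max M X j \<le> expected_max M X k"
  unfolding expected_max_def
proof (intro integral_mono integrable_Max int)
  fix \<omega> show "Max ((\<lambda>i. X i \<omega>) ` {1..j}) \<le> Max ((\<lambda>i. X i \<omega>) ` {1..k})"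
    using k by (intro Max_mono image_mono) auto
qed (use k in auto)

text \<open>Pointwise, the gain from adding candidate \<open>k + 2\<close> can only shrink when
  candidate \<open>k + 1\<close> is already included. After integration, \<open>T\<close> may be
  replaced by \<open>{1..k+1}\<close>: a transposition maps one onto the other.\<close>

lemma expected_max_concave:
  assumes ex: "exchangeable M n X" and int: "\<And>j. j \<in> {1..n} \<Longrightarrow> integrable M (X j)"
    and k: "1 \<le> k" "k + 2 \<le> n"
  shows "expected_max M X (k + 2) - expected_max M X (k + 1) \<le>
         expected_max M X (k + 1) - expected_max M X k"
proof -
  define F where "F S \<omega> = Max ((\<lambda>j. X j \<omega>) ` S)" for S \<omega>
  define T where "T = insert (k + 2) {1..k}"
  have F: "integrable M (F S)" if "S \<subseteq> {1..n}" "S \<noteq> {}" for S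
    unfolding F_def using that by (intro integrable_Max int) (auto intro: finite_subset)
  note F' = F[of "{1..k}"] F[of "{1..k+1}"] F[of "{1..k+2}"] F[of T]
  have eq: "{1..k+2} = insert (k + 2) (insert (k + 1) {1..k})" "{1..k+1} = insert (k + 1) {1..k}"
    by auto
  have "F (insert a S) \<omega> = max (X a \<omega>) (F S \<omega>)" if "finite S" "S \<noteq> {}" for a S \<omega>
    using that by (simp add: F_def)
  then have "F {1..k+2} \<omega> - F {1..k+1} \<omega> \<le> F T \<omega> - F {1..k} \<omega>" for \<omega>
    unfolding T_def eq using k by (auto simp: max_def)
  then have "(\<integral>\<omega>. F {1..k+2} \<omega> - F {1..k+1} \<omega> \<partial>M) \<le> (\<integral>\<omega>. F T \<omega> - F {1..k} \<omega> \<partial>M)"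
    using F' k by (intro integral_mono Bochner_Integration.integrable_diff) (auto simp: T_def)
  also have "\<dots> = (\<integral>\<omega>. F T \<omega> \<partial>M) - (\<integral>\<omega>. F {1..k} \<omega> \<partial>M)"
    using F' k by (intro Bochner_Integration.integral_diff) (auto simp: T_def)
  also have "(\<integral>\<omega>. F T \<omega> \<partial>M) = (\<integral>\<omega>. F {1..k+1} \<omega> \<partial>M)"
  proof -
    let ?p = "Transposition.transpose (k + 1) (k + 2)"
    have "?p ` {1..k+1} = T"
      unfolding eq(2) T_def image_insert by (auto simp: Transposition.transpose_def image_iff)
    moreover have "?p permutes {1..n}" using k by (intro permutes_swap_id) auto
    ultimately show ?thesis
      unfolding F_def using exchangeable_integral_Max[OF ex, of ?p "{1..k+1}"] k by auto
  qed
  also have "(\<integral>\<omega>. F {1..k+2} \<omega> - F {1..k+1} \<omega> \<partial>M) =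
      (\<integral>\<omega>. F {1..k+2} \<omega> \<partial>M) - (\<integral>\<omega>. F {1..k+1} \<omega> \<partial>M)"
    using F' k by (intro Bochner_Integration.integral_diff) auto
  finally show ?thesis by (simp add: F_def expected_max_def)
qed

section \<open>Threshold values relative to the mean\<close>

lemma sum_inverse_consecutive:
  assumes "1 \<le> m" "m < n"
  shows "(\<Sum>k=Suc m..<n. 1 / (real (k - 1) * real k)) = 1 / real m - 1 / real (n - 1)"
  using Suc_leI[OF assms(2)]
proof (induction n rule: dec_induct)
  case (step n)
  then obtain l where "n = Suc l" "l \<ge> 1" using assms by (cases n) auto
  then have "1 / (real (n - 1) * real n) = 1 / real (n - 1) - 1 / real n"
    by (simp add: divide_simps)
  with step show ?case by simp
qed simp

text \<open>The telescoped sum of \<open>1 / ((k - 1) k)\<close> cancels the weight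
  \<open>m / (n - 1)\<close> of the last candidate up to exactly one \<open>\<mu> 1\<close>. For
  \<open>m = n - 1\<close> the sum is empty.\<close>

lemma threshold_value_excess:
  assumes M: "prob_space M" and ex: "exchangeable M n X"
    and int: "\<And>k. k \<in> {1..n} \<Longrightarrow> integrable M (X k)"
    and m: "1 \<le> m" "m < n"
  defines "\<mu> \<equiv> expected_max M X"
  shows "threshold_value M n X (Suc m) =
    \<mu> 1 + real m * (\<Sum>k=Suc m..<n. (\<mu> k - \<mu> 1) / (real (k - 1) * real k))"
proof -
  have "{Suc m..n-1} = {Suc m..<n}" using m by auto
  then have "threshold_value M n X (Suc m) =
      real m * (\<Sum>k=Suc m..<n. \<mu> k / (real (k - 1) * real k)) + real m / real (n - 1) * \<mu> 1"
    using threshold_value_eq[OF M ex int, of "Suc m"] m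
    by (simp add: \<mu>_def expected_max_1[simplified] sum_distrib_left mult.commute)
  also have "(\<Sum>k=Suc m..<n. \<mu> k / (real (k - 1) * real k)) =
      (\<Sum>k=Suc m..<n. (\<mu> k - \<mu> 1) / (real (k - 1) * real k)) +
      \<mu> 1 * (\<Sum>k=Suc m..<n. 1 / (real (k - 1) * real k))"
    by (simp add: sum_distrib_left diff_divide_distrib flip: sum.distrib)
  finally show ?thesis
    unfolding sum_inverse_consecutive[OF m] using m by (simp add: algebra_simps)
qed

section \<open>The harmonic inequality for the optimal threshold\<close>

lemma optimal_threshold_props:
  fixes M :: "'a measure" and X :: "nat \<Rightarrow> 'a \<Rightarrow> real"
  assumes "1 \<le> n"
  defines "c \<equiv> optimal_threshold M n X"
  shows optimal_threshold_bounds: "1 \<le> c" "c \<le> n"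
    and threshold_value_less_optimal:
      "1 \<le> d \<Longrightarrow> d < c \<Longrightarrow> threshold_value M n X d < threshold_value M n X c"
proof -
  let ?V = "threshold_value M n X"
  let ?P = "\<lambda>c. c \<in> {1..n} \<and> (\<forall>d\<in>{1..n}. ?V d \<le> ?V c)"
  have "Max (?V ` {1..n}) \<in> ?V ` {1..n}" using assms by (intro Max_in) auto
  then obtain b where "b \<in> {1..n}" "?V b = Max (?V ` {1..n})" by auto
  then have "?P b" by auto
  then have P: "?P c" unfolding c_def optimal_threshold_def by (rule LeastI)
  then show "1 \<le> c" "c \<le> n" by auto
  show "?V d < ?V c" if "1 \<le> d" "d < c"
  proof -
    \<comment> \<open>By minimality of \<open>c\<close>, the smaller \<open>d\<close> is not a
      maximizer, so some \<open>d'\<close> beats it, and \<open>c\<close> is at least as good as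
      \<open>d'\<close>.\<close>
    have "\<not> ?P d" using that(2) unfolding c_def optimal_threshold_def by (rule not_less_Least)
    moreover have "d \<in> {1..n}" using that P by auto
    ultimately obtain d' where "d' \<in> {1..n}" "?V d < ?V d'" by (auto simp: not_le)
    with P show ?thesis by fastforce
  qed
qed

lemma optimal_threshold_harmonic:
  fixes X :: "nat \<Rightarrow> 'a \<Rightarrow> real"
  assumes M: "prob_space M" and ex: "exchangeable M n X"
    and int: "\<And>k. k \<in> {1..n} \<Longrightarrow> integrable M (X k)"
    and n: "1 \<le> n" and c: "optimal_threshold M n X = Suc m" "1 \<le> m"
  shows "1 < (\<Sum>k=m..<n. 1 / real k)"
proof -
  define \<mu> where "\<mu> = expected_max M X"
  define G where "G m = (\<Sum>k=Suc m..<n. (\<mu> k - \<mu> 1) / (real (k - 1) * real k))" for m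
  let ?V = "threshold_value M n X"
  have mn: "m < n" using optimal_threshold_bounds(2)[OF n, of M X] c by simp
  have less: "?V m < ?V (Suc m)"
    using threshold_value_less_optimal[OF n, of m M X] c by simp
  have V: "?V (Suc j) = \<mu> 1 + real j * G j" if "1 \<le> j" "j < n" for j
    unfolding \<mu>_def G_def using threshold_value_excess[OF M ex int that] by simp
  show ?thesis
  proof (cases "m = 1")
    \<comment> \<open>Here \<open>V 1\<close> falls outside the formula \<open>V\<close> and the
      slope denominator \<open>m - 1\<close> vanishes. Positivity of \<open>G 1\<close> forces
      \<open>n > 2\<close>, so the sum contains 1 + 1/2.\<close>
    case True
    have "?V 1 = \<mu> 1" using threshold_value_1[OF n, of M X] by (simp add: \<mu>_def expected_max_1[simplified])
    then have "G 1 > 0" using less V[of 1] True mn by simp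
    then have "n \<noteq> 2" by (auto simp: G_def)
    then have "{1..<n} = insert 1 (insert 2 {3..<n})" using True mn by auto
    moreover have "0 \<le> (\<Sum>k=3..<n. 1 / real k)" by (intro sum_nonneg) auto
    ultimately show ?thesis using True by simp
  next
    case False
    then have m2: "m \<ge> 2" using c by simp
    obtain l where l: "m = Suc l" "l \<ge> 1" using m2 by (cases m) auto
    let ?a = "\<mu> m - \<mu> 1"
    \<comment> \<open>Splitting off the term \<open>k = m\<close> puts both values in terms of
      \<open>G m\<close>; \<open>less\<close> then becomes \<open>lower\<close>.\<close>
    have "G l = ?a / (real l * real m) + G m"
      using mn l by (simp add: G_def sum.atLeast_Suc_lessThan)
    then have "real l * G l = ?a / real m + real l * G m"
      using l(2) by (simp add: distrib_left)
    moreover have "real l * G l < real m * G m"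
      using less V[of l] V[of m] l mn by simp
    ultimately have lower: "?a / real m < G m"
      using l by (simp add: algebra_simps)
    have slope: "(\<mu> k - \<mu> 1) / real (k - 1) \<le> ?a / real l" if "k \<in> {Suc m..<n}" for k
    proof -
      \<comment> \<open>The sequence is shifted by one so that its chords start at
        \<open>\<mu> 1\<close>.\<close>
      have "((\<mu> (Suc (k-1)) - \<mu> (Suc 0)) / real (k-1)) \<le> (\<mu> (Suc l) - \<mu> (Suc 0)) / real l"
      proof (rule concave_seq_slope_antimono[of "n - 1" "\<lambda>k. \<mu> (Suc k)"])
        fix j assume "j + 2 \<le> n - 1"
        then show "\<mu> (Suc (j + 2)) - \<mu> (Suc (j + 1)) \<le> \<mu> (Suc (j + 1)) - \<mu> (Suc j)"
          using expected_max_concave[OF ex int, of "Suc j"] by (simp add: \<mu>_def)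
      qed (use l that in auto)
      then show ?thesis using that l by simp
    qed
    have "G m \<le> (\<Sum>k=Suc m..<n. ?a / real l * (1 / real k))"
      unfolding G_def
    proof (rule sum_mono)
      fix k assume "k \<in> {Suc m..<n}"
      from mult_right_mono[OF slope[OF this], of "1 / real k"]
      show "(\<mu> k - \<mu> 1) / (real (k - 1) * real k) \<le> ?a / real l * (1 / real k)" by simp
    qed
    also have "\<dots> = ?a / real l * (\<Sum>k=Suc m..<n. 1 / real k)" by (simp add: sum_distrib_left)
    finally have upper: "G m \<le> ?a / real l * (\<Sum>k=Suc m..<n. 1 / real k)" .
    have a: "?a \<ge> 0" unfolding \<mu>_def using expected_max_mono[of n M X 1 m] int mn c by simp
    \<comment> \<open>Otherwise \<open>upper\<close> would give \<open>G m \<le> ?a / m\<close>,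
      against \<open>lower\<close>. The bound \<open>l / m = 1 - 1 / m\<close> leaves room for
      exactly the missing term \<open>k = m\<close>.\<close>
    have "\<not> (\<Sum>k=Suc m..<n. 1 / real k) \<le> real l / real m"
    proof
      assume "(\<Sum>k=Suc m..<n. 1 / real k) \<le> real l / real m"
      then have "?a / real l * (\<Sum>k=Suc m..<n. 1 / real k) \<le> ?a / real l * (real l / real m)"
        using a by (intro mult_left_mono) auto
      with lower upper l show False by simp
    qed
    moreover have "real l / real m = 1 - 1 / real m" using l by (simp add: field_simps)
    ultimately show ?thesis using mn by (simp add: sum.atLeast_Suc_lessThan)
  qed
qed

section \<open>Logarithmic bound and asymptotics\<close>

lemma harmonic_sum_le_ln:
  assumes "2 \<le> m" "m \<le> n"
  shows "(\<Sum>k=m..<n. 1 / real k) \<le> ln (real (n - 1) / real (m - 1))"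
  using assms(2)
proof (induction n rule: dec_induct)
  case (step n)
  have n: "n \<ge> 2" using step assms by simp
  \<comment> \<open>Negated, this is \<open>1 / n \<le> ln n - ln (n - 1)\<close>, whose right side
    telescopes.\<close>
  have "ln (real (n - 1) / real n) \<le> real (n - 1) / real n - 1"
    using n by (intro ln_le_minus_one) auto
  also have "\<dots> = - (1 / real n)" using n by (simp add: field_simps of_nat_diff)
  finally show ?case using step n assms by (simp add: ln_div)
qed (use assms in simp)

text \<open>For a threshold \<open>m + 1\<close> with \<open>m \<ge> 2\<close>, exponentiating the
  harmonic inequality bounds \<open>m - 1\<close> by \<open>n / e\<close>; this shift by 2 is the
  additive constant, which also covers thresholds up to 2.\<close>

lemma optimal_threshold_le:
  fixes X :: "nat \<Rightarrow> 'a \<Rightarrow> real"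
  assumes "prob_space M" "exchangeable M n X" "\<And>k. k \<in> {1..n} \<Longrightarrow> integrable M (X k)" "1 \<le> n"
  shows "real (optimal_threshold M n X) \<le> real n / exp 1 + 2"
proof (cases "optimal_threshold M n X \<le> 2")
  case True
  then show ?thesis by (simp add: add_increasing)
next
  case False
  then obtain m where m: "optimal_threshold M n X = Suc m" "2 \<le> m"
    by (cases "optimal_threshold M n X") auto
  then have mn: "m < n" using optimal_threshold_bounds(2)[OF assms(4), of M X] by simp
  have "1 < (\<Sum>k=m..<n. 1 / real k)"
    using m by (intro optimal_threshold_harmonic[OF assms]) auto
  also have "\<dots> \<le> ln (real (n - 1) / real (m - 1))"
    using m mn by (intro harmonic_sum_le_ln) auto
  finally have "exp 1 < exp (ln (real (n - 1) / real (m - 1)))"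
    by simp
  also have "\<dots> = real (n - 1) / real (m - 1)"
    using m mn by (intro exp_ln divide_pos_pos) auto
  finally have "exp 1 < real (n - 1) / real (m - 1)" .
  then have "real (m - 1) * exp 1 < real (n - 1)"
    using m by (simp add: pos_less_divide_eq mult.commute)
  then have "real (m - 1) < real n / exp 1" by (simp add: pos_less_divide_eq)
  with m show ?thesis by simp
qed

lemma optimal_threshold_ereal_harmonic:
  fixes X :: "nat \<Rightarrow> 'a \<Rightarrow> real"
  assumes "prob_space M" "exchangeable M n X" "\<And>k. k \<in> {1..n} \<Longrightarrow> integrable M (X k)" "1 \<le> n"
  shows "(\<Sum>k = optimal_threshold M n X - 1..n - 1. 1 / ereal (real k)) > 1"
proof -
  obtain m where m: "optimal_threshold M n X = Suc m"
    using optimal_threshold_bounds(1)[OF assms(4), of M X] by (cases "optimal_threshold M n X") auto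
  have eq: "{m..n - 1} = {m..<n}" using assms(4) by auto
  show ?thesis
  proof (cases "m = 0")
    case True
    \<comment> \<open>Division in \<open>ereal\<close> gives \<open>1 / 0 = \<infinity>\<close>, the
      convention wanted for threshold 1.\<close>
    have "(\<Sum>k = 0..n - 1. 1 / ereal (real k)) = \<infinity>"
      by (simp add: sum.atLeast_Suc_atMost[of 0])
    then show ?thesis using m True by simp
  next
    case False
    then have "1 < (\<Sum>k=m..<n. 1 / real k)"
      using m by (intro optimal_threshold_harmonic[OF assms]) auto
    moreover have "(\<Sum>k=m..<n. 1 / ereal (real k)) = ereal (\<Sum>k=m..<n. 1 / real k)"
      using False by (subst sum_ereal[symmetric], intro sum.cong) (auto simp: one_ereal_def)
    ultimately show ?thesis using m by (simp add: eq del: One_nat_def)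
  qed
qed

theorem theorem2p1:
  shows "(\<forall>(n::nat) (M::'a measure) (X :: nat \<Rightarrow> 'a \<Rightarrow> real).
            n \<ge> 1 \<longrightarrow> prob_space M \<longrightarrow> exchangeable M n X \<longrightarrow>
            (\<forall>k\<in>{1..n}. integrable M (X k)) \<longrightarrow>
            (\<Sum>k = optimal_threshold M n X - 1..n - 1. 1 / ereal (real k)) > 1) \<and>
         (\<forall>(M :: nat \<Rightarrow> 'b measure) (X :: nat \<Rightarrow> nat \<Rightarrow> 'b \<Rightarrow> real).
            (\<forall>n\<ge>1. prob_space (M n) \<and> exchangeable (M n) n (X n) \<and>
                    (\<forall>k\<in>{1..n}. integrable (M n) (X n k))) \<longrightarrow>
            limsup (\<lambda>n. ereal (real (optimal_threshold (M n) n (X n)) / real n)) \<le> ereal (1 / exp 1))"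
proof (intro conjI allI impI)
  fix n and M :: "'a measure" and X
  assume "n \<ge> 1" "prob_space M" "exchangeable M n X" "\<forall>k\<in>{1..n}. integrable M (X k)"
  then show "(\<Sum>k = optimal_threshold M n X - 1..n - 1. 1 / ereal (real k)) > 1"
    by (intro optimal_threshold_ereal_harmonic) auto
next
  fix M :: "nat \<Rightarrow> 'b measure" and X
  assume A: "\<forall>n\<ge>1. prob_space (M n) \<and> exchangeable (M n) n (X n) \<and>
                    (\<forall>k\<in>{1..n}. integrable (M n) (X n k))"
  let ?r = "\<lambda>n. real (optimal_threshold (M n) n (X n)) / real n"
  have "ereal (?r n) \<le> ereal (1 / exp 1 + 2 / real n)" if "n \<ge> 1" for n
  proof -
    have "real (optimal_threshold (M n) n (X n)) \<le> real n / exp 1 + 2"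
      using A that by (intro optimal_threshold_le) auto
    then have "?r n \<le> (real n / exp 1 + 2) / real n" by (rule divide_right_mono) simp
    also have "\<dots> = 1 / exp 1 + 2 / real n" using that by (simp add: add_divide_distrib)
    finally show ?thesis by simp
  qed
  \<comment> \<open>The bound is needed only eventually, so \<open>n = 0\<close> does no
    harm.\<close>
  then have "limsup (\<lambda>n. ereal (?r n)) \<le> limsup (\<lambda>n. ereal (1 / exp 1 + 2 / real n))"
    by (intro Limsup_mono) (auto intro: eventually_sequentiallyI)
  also have "\<dots> = ereal (1 / exp 1)"
  proof (intro lim_imp_Limsup tendsto_ereal)
    have "(\<lambda>n. 1 / exp 1 + 2 / real n) \<longlonglongrightarrow> 1 / exp (1::real) + 0"
      by (intro tendsto_add tendsto_const lim_const_over_n)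
    then show "(\<lambda>n. 1 / exp 1 + 2 / real n) \<longlonglongrightarrow> 1 / exp (1::real)" by simp
  qed simp
  finally show "limsup (\<lambda>n. ereal (?r n)) \<le> ereal (1 / exp 1)" .
qed

end
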